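(* (Scheme II.) Set, for all $k\in\mathcal{K}$, $\sqrt{p_k}=\frac{\sqrt{P_k}}{G}$ and $w_k=\frac{1}{\beta_k\sqrt{P_k}}$, set the denoising factor $$\lambda=\frac{\pi NK}{4G\sqrt{\sum_{k=1}^{K}w_k^{2}}},$$ and set the RIS phase shifts $$\theta_n=-\angle h_{p,n}^\ast+\angle\sum_{k=1}^{K}\frac{1}{\beta_k\sqrt{P_k}}h_{r,k,n}^\ast,\qquad n=1,\dots,N.$$ Then the gradient estimate $\hat{\mathbf{g}}_t$ is unbiased: $\mathbb{E}[\hat{\mathbf{g}}_t]=\mathbf{g}_t$ (expectation over channels and noise, the vectors $\mathbf{g}_{t,k},\tilde{\mathbf{g}}_{t,m}$ being fixed), i.e. $\mathbb{E}[\ell_k]=\frac1K$ for all $k\in\mathcal{K}$ and $\mathbb{E}[\ell_m]=0$ for all $m\in\mathcal{M}$.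
   Context: Let $K,N,M,D\ge 1$ be integers, $\mathcal{K}=\{1,\dots,K\}$ (target devices) and $\mathcal{M}=\{K+1,\dots,K+M\}$ (interferers). The random vectors $\mathbf{h}_p$ and $\mathbf{h}_{r,i}$, $i\in\mathcal{K}\cup\mathcal{M}$, with entries $h_{p,n}$, $h_{r,i,n}$, are mutually independent, each distributed as $\mathcal{CN}(\mathbf{0},\mathbf{I}_N)$ (i.i.d. circularly symmetric complex Gaussian entries of mean $0$ and variance $\mathbb{E}|\cdot|^2=1$), and independent of the noise $\mathbf{z}_t\sim\mathcal{CN}(\mathbf{0},\sigma^2\mathbf{I}_D)$. Deterministic constants: $\beta_i>0$ (large-scale fading), $P_k>0$ (maximum transmit powers), $p_i>0$ (transmit power coefficients), $\lambda>0$ (denoising factor), $G>0$. The local gradients $\mathbf{g}_{t,k}\in\mathbb{R}^D$ satisfy $\|\mathbf{g}_{t,k}\|\le G$; the interference signals $\tilde{\mathbf{g}}_{t,m}\in\mathbb{R}^D$ are arbitrary with $\|\tilde{\mathbf{g}}_{t,m}\|=1$. The reflecting matrix is $\mathbf{\Theta}=\mathrm{diag}\{e^{j\theta_1},\dots,e^{j\theta_N}\}$, $j=\sqrt{-1}$ (phases modulo $2\pi$); $\angle$ is the argument, $^\ast$ conjugation, $^H$ conjugate transpose, $\Re$ the real part. For $i\in\mathcal{K}\cup\mathcal{M}$, $$\ell_i=\frac{\beta_i\sqrt{p_i}}{\lambda}\,\Re\{\mathbf{h}_p^H\mathbf{\Theta}\mathbf{h}_{r,i}\}.$$ The true global gradient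 is $\mathbf{g}_t=\frac1K\sum_{k\in\mathcal{K}}\mathbf{g}_{t,k}$ and its estimate is $$\hat{\mathbf{g}}_t=\sum_{k\in\mathcal{K}}\ell_k\mathbf{g}_{t,k}+\sum_{m\in\mathcal{M}}\ell_m\tilde{\mathbf{g}}_{t,m}+\frac{\Re\{\mathbf{z}_t\}}{\lambda}.$$ *)

theory Defs
  imports "HOL-Probability.Probability"
begin

text \<open>Centred real Gaussian of variance \<open>v \<ge> 0\<close>. \<^const>\<open>normal_density\<close> is a density
  only for positive standard deviation, hence the separate point-mass case.\<close>

definition centred_normal :: "'a measure \<Rightarrow> real \<Rightarrow> ('a \<Rightarrow> real) \<Rightarrow> bool" where
  "centred_normal \<Omega> v X \<longleftrightarrow>
     (if v = 0 then X \<in> borel_measurable \<Omega> \<and> (AE \<omega> in \<Omega>. X \<omega> = 0)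
      else distributed \<Omega> lborel X (\<lambda>x. ennreal (normal_density 0 (sqrt v) x)))"

text \<open>Circularly symmetric with \<open>\<E>\<bar>X\<bar>\<^sup>2 = v\<close>: real and imaginary part each carry variance \<open>v / 2\<close>.\<close>

definition complex_normal :: "'a measure \<Rightarrow> real \<Rightarrow> ('a \<Rightarrow> complex) \<Rightarrow> bool" where
  "complex_normal \<Omega> v X \<longleftrightarrow>
     X \<in> borel_measurable \<Omega> \<and>
     centred_normal \<Omega> (v / 2) (\<lambda>\<omega>. Re (X \<omega>)) \<and>
     centred_normal \<Omega> (v / 2) (\<lambda>\<omega>. Im (X \<omega>)) \<and>
     prob_space.indep_var \<Omega> borel (\<lambda>\<omega>. Re (X \<omega>)) borel (\<lambda>\<omega>. Im (X \<omega>))"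

text \<open>\<open>X \<sim> CN(0, v I)\<close>\<close>

definition complex_normal_vec :: "'a measure \<Rightarrow> real \<Rightarrow> ('a \<Rightarrow> complex ^ 'n) \<Rightarrow> bool" where
  "complex_normal_vec \<Omega> v X \<longleftrightarrow>
     X \<in> borel_measurable \<Omega> \<and>
     prob_space.indep_vars \<Omega> (\<lambda>_. borel) (\<lambda>n \<omega>. X \<omega> $ n) UNIV \<and>
     (\<forall>n. complex_normal \<Omega> v (\<lambda>\<omega>. X \<omega> $ n))"

text \<open>The channels and the noise live in spaces of different dimension, so their mutual
  independence cannot be stated with \<^const>\<open>prob_space.indep_vars\<close>, which requires one common
  value type; it is stated for the events they generate.\<close>

datatype source = Direct | Reflected nat | Noise

definition generated_events :: "'a measure \<Rightarrow> ('a \<Rightarrow> 'b::topological_space) \<Rightarrow> 'a set set" where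
  "generated_events \<Omega> X = {X -` A \<inter> space \<Omega> | A. A \<in> sets borel}"

definition sources_independent ::
  "'a measure \<Rightarrow> nat set \<Rightarrow> ('a \<Rightarrow> complex ^ 'n) \<Rightarrow> (nat \<Rightarrow> 'a \<Rightarrow> complex ^ 'n)
     \<Rightarrow> ('a \<Rightarrow> complex ^ 'd) \<Rightarrow> bool" where
  "sources_independent \<Omega> I hp hr z \<longleftrightarrow>
     prob_space.indep_sets \<Omega>
       (\<lambda>s. case s of Direct \<Rightarrow> generated_events \<Omega> hp
                    | Reflected i \<Rightarrow> generated_events \<Omega> (hr i)
                    | Noise \<Rightarrow> generated_events \<Omega> z)
       ({Direct, Noise} \<union> Reflected ` I)"

definition herm_prod :: "complex ^ 'n \<Rightarrow> complex ^ 'n \<Rightarrow> complex" where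
  "herm_prod x y = (\<Sum>n\<in>UNIV. cnj (x $ n) * y $ n)"

definition reflecting_matrix :: "real ^ 'n \<Rightarrow> complex ^ 'n ^ 'n" where
  "reflecting_matrix \<theta> = (\<chi> i j. if i = j then cis (\<theta> $ i) else 0)"

definition coeff_ell ::
  "real \<Rightarrow> real \<Rightarrow> real \<Rightarrow> real ^ 'n \<Rightarrow> complex ^ 'n \<Rightarrow> complex ^ 'n \<Rightarrow> real" where
  "coeff_ell \<beta> p lam \<theta> hp hr =
     \<beta> * sqrt p / lam * Re (herm_prod hp (reflecting_matrix \<theta> *v hr))"

text \<open>The value \<open>Arg 0 = 0\<close> is only used on a null set.\<close>

definition phases_II ::
  "nat \<Rightarrow> (nat \<Rightarrow> real) \<Rightarrow> (nat \<Rightarrow> real) \<Rightarrow> complex ^ 'n \<Rightarrow> (nat \<Rightarrow> complex ^ 'n) \<Rightarrow> real ^ 'n" where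
  "phases_II K \<beta> P hp hr =
     (\<chi> n. - Arg (cnj (hp $ n))
           + Arg (\<Sum>k=1..K. complex_of_real (1 / (\<beta> k * sqrt (P k))) * cnj (hr k $ n)))"

definition true_gradient :: "nat \<Rightarrow> (nat \<Rightarrow> real ^ 'd) \<Rightarrow> real ^ 'd" where
  "true_gradient K g = (1 / real K) *\<^sub>R (\<Sum>k=1..K. g k)"

definition gradient_estimate ::
  "nat \<Rightarrow> nat \<Rightarrow> real \<Rightarrow> (nat \<Rightarrow> real) \<Rightarrow> (nat \<Rightarrow> real ^ 'd) \<Rightarrow> (nat \<Rightarrow> real ^ 'd)
     \<Rightarrow> complex ^ 'd \<Rightarrow> real ^ 'd" where
  "gradient_estimate K M lam ell g gi z =
     (\<Sum>k=1..K. ell k *\<^sub>R g k) + (\<Sum>m=K+1..K+M. ell m *\<^sub>R gi m)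
       + (1 / lam) *\<^sub>R (\<chi> d. Re (z $ d))"

end

theory Submission
  imports Defs
begin

text \<open>The phases turn the \<open>n\<close>-th summand of \<open>\<Re>(h\<^sub>p\<^sup>H \<Theta> h\<^sub>i)\<close> into \<open>\<bar>h\<^sub>p\<^sub>,\<^sub>n\<bar> \<Re>(u h\<^sub>i\<^sub>,\<^sub>n)\<close>, where \<open>u S = \<bar>S\<bar>\<close>, \<open>\<bar>u\<bar> = 1\<close>
  and \<open>S = \<Sum>\<^sub>k w\<^sub>k h\<^sub>k\<^sub>,\<^sub>n\<close>; the two factors are independent. The second one is a subgradient of the modulus:
  \<open>\<bar>S + t h\<bar> \<ge> \<bar>S\<bar> + t \<Re>(u h)\<close> for all real \<open>t\<close>. Its expectation is therefore the slope at \<open>0\<close> of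
  \<open>t \<mapsto> \<E>\<bar>S + t h\<bar>\<close>, a function that is known explicitly because a sum of independent complex Gaussians
  with total variance \<open>W\<close> has mean modulus \<open>\<surd>(\<pi> W) / 2\<close>. This avoids conditioning on \<open>S\<close>, and the
  event \<open>S = 0\<close> needs no separate treatment.\<close>

section \<open>Rotational averages and measurability of phase maps\<close>

text \<open>Expresses the mean modulus of an isotropic complex variable by the first absolute moment of
  its one-dimensional projections.\<close>

lemma integral_abs_Re_cis_mult:
  "((\<lambda>\<phi>. \<bar>Re (cis \<phi> * z)\<bar>) has_integral 2 * cmod z) {-(pi/2)..pi/2}"
proof -
  \<comment> \<open>\<open>Arg2pi\<close> rather than \<open>Arg\<close> makes the shift
    non-negative, which keeps the endpoints below in order for splitting integrals.\<close>
  define \<alpha> where "\<alpha> = Arg2pi z"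
  have \<alpha>: "\<alpha> \<ge> 0" unfolding \<alpha>_def using Arg2pi_ge_0 by blast
  have z: "z = of_real (cmod z) * cis \<alpha>"
    unfolding \<alpha>_def using Arg2pi_eq[of z] by (simp add: cis_conv_exp)
  let ?f = "\<lambda>x::real. \<bar>cos x\<bar>" and ?a = "-(pi/2)" and ?b = "pi/2"
  have cont: "continuous_on S ?f" for S by (intro continuous_intros)
  note int = integrable_continuous_real[OF cont]
  have "integral {?a..?a + \<alpha>} ?f = integral {?a..?a + \<alpha>} (?f \<circ> (\<lambda>x. x + pi))"
    by (simp add: o_def)
  also have "\<dots> = integral {?a + pi..?a + \<alpha> + pi} ?f"
    by (rule integral_shift) (rule cont)
  finally have periodic: "integral {?a..?a + \<alpha>} ?f = integral {?b..?b + \<alpha>} ?f"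
    by (simp add: field_simps)
  have "integral {?a..?b} (\<lambda>\<phi>. \<bar>cos (\<phi> + \<alpha>)\<bar>) = integral {?a..?b} (?f \<circ> (\<lambda>x. x + \<alpha>))"
    by (simp add: o_def)
  also have "\<dots> = integral {?a + \<alpha>..?b + \<alpha>} ?f"
    by (rule integral_shift) (rule cont)
  \<comment> \<open>The interval from \<open>?a\<close> to \<open>?b + \<alpha>\<close> is split
    once at \<open>?a + \<alpha>\<close> and once at \<open>?b\<close>. The two outer pieces agree
    since \<open>?f\<close> has period \<open>pi\<close>, so they cancel however large \<alpha>
    is.\<close>
  also have "integral {?a..?a + \<alpha>} ?f + \<dots> = integral {?a..?b + \<alpha>} ?f"
    using \<alpha> by (intro Henstock_Kurzweil_Integration.integral_combine int) auto
  also have "\<dots> = integral {?a..?b} ?f + integral {?b..?b + \<alpha>} ?f"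
    using \<alpha> by (intro Henstock_Kurzweil_Integration.integral_combine[symmetric] int) auto
  finally have "integral {?a..?b} (\<lambda>\<phi>. \<bar>cos (\<phi> + \<alpha>)\<bar>) = integral {?a..?b} ?f"
    using periodic by simp
  also have "(?f has_integral sin ?b - sin ?a) {?a..?b}"
  proof (rule fundamental_theorem_of_calculus)
    fix x assume "x \<in> {?a..?b}"
    then have "cos x \<ge> 0" by (intro cos_ge_zero) auto
    then show "(sin has_vector_derivative ?f x) (at x within {?a..?b})"
      by (auto simp flip: has_real_derivative_iff_has_vector_derivative intro!: derivative_eq_intros)
  qed simp
  then have "integral {?a..?b} ?f = 2" by (simp add: integral_unique)
  finally have "((\<lambda>\<phi>. \<bar>cos (\<phi> + \<alpha>)\<bar>) has_integral 2) {?a..?b}"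
    using integrable_integral[OF integrable_continuous_real[of ?a ?b "\<lambda>\<phi>. \<bar>cos (\<phi> + \<alpha>)\<bar>"]]
    by (simp add: continuous_intros)
  then have "((\<lambda>\<phi>. cmod z * \<bar>cos (\<phi> + \<alpha>)\<bar>) has_integral cmod z * 2) {?a..?b}"
    by (rule has_integral_mult_right)
  moreover have "\<bar>Re (cis \<phi> * z)\<bar> = cmod z * \<bar>cos (\<phi> + \<alpha>)\<bar>" for \<phi>
  proof -
    have "cis \<phi> * z = of_real (cmod z) * cis (\<phi> + \<alpha>)"
      by (subst z) (simp add: mult_ac flip: cis_mult)
    moreover have "Re (of_real (cmod z) * cis (\<phi> + \<alpha>)) = cmod z * cos (\<phi> + \<alpha>)" by simp
    ultimately show ?thesis by (simp only: abs_mult abs_norm_cancel)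
  qed
  ultimately show ?thesis by (simp add: mult.commute)
qed

lemma measurable_vec_nth [measurable]: "(\<lambda>x::'b::real_normed_vector ^ 'n. x $ n) \<in> borel_measurable borel"
  by (intro borel_measurable_continuous_onI continuous_intros)

lemma measurable_cnj [measurable]: "cnj \<in> borel_measurable borel"
  by (intro borel_measurable_continuous_onI continuous_intros)

text \<open>\<open>Arg\<close> jumps along the negative real axis, but \<open>cis\<close> removes
  the jump: away from 0 the composition is \<open>sgn\<close>.\<close>

lemma measurable_cis_Arg [measurable]: "(\<lambda>z. cis (Arg z)) \<in> borel_measurable borel"
proof -
  have "cis (Arg z) = (if z = 0 then 1 else sgn z)" for z
    by (simp add: Arg_zero cis_Arg)
  then show ?thesis by simp
qed

section \<open>Centred real Gaussian variables\<close>

context prob_space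
begin

lemma centred_normal_measurable:
  "centred_normal M v X \<Longrightarrow> X \<in> borel_measurable M"
  by (auto simp: centred_normal_def distributed_def split: if_splits)

text \<open>Serves addition with a degenerate summand: the sum then agrees almost everywhere with
  the other summand.\<close>

lemma centred_normal_cong_AE:
  assumes "centred_normal M v X" "AE \<omega> in M. X \<omega> = Y \<omega>" "Y \<in> borel_measurable M"
  shows "centred_normal M v Y"
proof (cases "v = 0")
  case True
  then show ?thesis using assms by (auto simp: centred_normal_def)
next
  case False
  have "distr M lborel X = distr M lborel Y"
    using assms centred_normal_measurable[OF assms(1)] by (intro distr_cong_AE) auto
  with False assms show ?thesis by (auto simp: centred_normal_def distributed_def)
qed

lemma centred_normal_cmult:
  assumes "centred_normal M v X" "v \<ge> 0"
  shows "centred_normal M (c\<^sup>2 * v) (\<lambda>\<omega>. c * X \<omega>)"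
proof -
  note [measurable] = centred_normal_measurable[OF assms(1)]
  show ?thesis
  \<comment> \<open>A zero factor does occur later: the sine or cosine of a rotation angle, or a
    zero weight. The product is then a point mass at 0, outside the scope of the affine rule for
    densities.\<close>
  proof (cases "v = 0 \<or> c = 0")
    case True
    then show ?thesis using assms by (auto simp: centred_normal_def)
  next
    case False
    with assms have "distributed M lborel (\<lambda>\<omega>. 0 + c * X \<omega>) (normal_density (0 + c * 0) (\<bar>c\<bar> * sqrt v))"
      by (intro normal_density_affine) (auto simp: centred_normal_def)
    with False show ?thesis by (simp add: centred_normal_def real_sqrt_mult)
  qed
qed

lemma centred_normal_add:
  assumes X: "centred_normal M v X" "v \<ge> 0" and Y: "centred_normal M w Y" "w \<ge> 0"
    and ind: "indep_var borel X borel Y"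
  shows "centred_normal M (v + w) (\<lambda>\<omega>. X \<omega> + Y \<omega>)"
proof -
  note [measurable] = centred_normal_measurable[OF X(1)] centred_normal_measurable[OF Y(1)]
  consider "v = 0" | "w = 0" | "v > 0" "w > 0" using assms by fastforce
  then show ?thesis
  proof cases
    case 1
    then have "AE \<omega> in M. Y \<omega> = X \<omega> + Y \<omega>" using X by (auto simp: centred_normal_def)
    with 1 show ?thesis using centred_normal_cong_AE[OF Y(1)] by auto
  next
    case 2
    then have "AE \<omega> in M. X \<omega> = X \<omega> + Y \<omega>" using Y by (auto simp: centred_normal_def)
    with 2 show ?thesis using centred_normal_cong_AE[OF X(1)] by auto
  next
    case 3
    then have "distributed M lborel (\<lambda>\<omega>. X \<omega> + Y \<omega>) (normal_density (0 + 0) (sqrt ((sqrt v)\<^sup>2 + (sqrt w)\<^sup>2)))"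
      using X Y by (intro add_indep_normal ind) (auto simp: centred_normal_def)
    with 3 show ?thesis by (simp add: centred_normal_def)
  qed
qed

lemma centred_normal_sum:
  assumes "finite I" "indep_vars (\<lambda>_. borel) X I"
    and "\<And>i. i \<in> I \<Longrightarrow> centred_normal M (v i) (X i)" "\<And>i. i \<in> I \<Longrightarrow> v i \<ge> 0"
  shows "centred_normal M (\<Sum>i\<in>I. v i) (\<lambda>\<omega>. \<Sum>i\<in>I. X i \<omega>)"
  using assms
proof (induction I rule: finite_induct)
  case empty
  then show ?case by (simp add: centred_normal_def)
next
  case (insert i I)
  then have "indep_var borel (X i) borel (\<lambda>\<omega>. \<Sum>i\<in>I. X i \<omega>)"
    by (intro indep_vars_sum)
  moreover have "centred_normal M (\<Sum>i\<in>I. v i) (\<lambda>\<omega>. \<Sum>i\<in>I. X i \<omega>)"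
    using insert.prems by (intro insert.IH indep_vars_subset[OF insert.prems(1)]) auto
  ultimately show ?case using insert by (auto intro!: centred_normal_add sum_nonneg)
qed

lemma centred_normal_expectation:
  assumes "centred_normal M v X" "v \<ge> 0"
  shows "integrable M X" "expectation X = 0"
    "integrable M (\<lambda>\<omega>. \<bar>X \<omega>\<bar>)" "expectation (\<lambda>\<omega>. \<bar>X \<omega>\<bar>) = sqrt (2 * v / pi)"
proof -
  note [measurable] = centred_normal_measurable[OF assms(1)]
  have "integrable M X \<and> expectation X = 0 \<and>
    expectation (\<lambda>\<omega>. \<bar>X \<omega>\<bar>) = sqrt (2 * v / pi)"
  proof (cases "v = 0")
    case True
    then have "AE \<omega> in M. X \<omega> = 0" using assms by (simp add: centred_normal_def)
    then have "has_bochner_integral M X 0" "has_bochner_integral M (\<lambda>\<omega>. \<bar>X \<omega>\<bar>) 0"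
      using has_bochner_integral_zero[of M] by (auto elim!: has_bochner_integral_cong_AE[THEN iffD1, rotated -1])
    with True show ?thesis by (simp add: has_bochner_integral_iff)
  next
    case False
    with assms have D: "distributed M lborel X (normal_density 0 (sqrt v))"
      by (simp add: centred_normal_def)
    \<comment> \<open>The odd moments of order \<open>2 * k + 1\<close>, plain and absolute, are
      taken at \<open>k = 0\<close>.\<close>
    have "has_bochner_integral lborel (\<lambda>x. normal_density 0 (sqrt v) x * x) 0"
      using normal_moment_odd[of "sqrt v" 0 0] False assms(2) by simp
    moreover have "has_bochner_integral lborel (\<lambda>x. normal_density 0 (sqrt v) x * \<bar>x\<bar>) (sqrt v * sqrt (2 / pi))"
      using normal_moment_abs_odd[of "sqrt v" 0 0] False assms(2) by simp
    moreover have "sqrt v * sqrt (2 / pi) = sqrt (2 * v / pi)" by (simp flip: real_sqrt_mult add: mult.commute)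
    ultimately show ?thesis
      using distributed_integrable[OF D, of "\<lambda>x. x"] distributed_integral[OF D, of "\<lambda>x. x"]
        distributed_integral[OF D, of "\<lambda>x. \<bar>x\<bar>"]
      by (simp add: has_bochner_integral_iff)
  qed
  then show "integrable M X" "expectation X = 0"
    "integrable M (\<lambda>\<omega>. \<bar>X \<omega>\<bar>)" "expectation (\<lambda>\<omega>. \<bar>X \<omega>\<bar>) = sqrt (2 * v / pi)" by auto
qed

section \<open>Mean modulus of complex Gaussian sums\<close>

text \<open>Circular symmetry: the rotated real part is
  \<open>cos \<phi> * Re X - sin \<phi> * Im X\<close>, a combination of independent Gaussians whose
  variances add up because the squares of sine and cosine sum to 1.\<close>

lemma complex_normal_rotate:
  assumes "complex_normal M v X" "v \<ge> 0"
  shows "centred_normal M (v / 2) (\<lambda>\<omega>. Re (cis \<phi> * X \<omega>))"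
proof -
  have ind: "indep_var borel (\<lambda>\<omega>. Re (X \<omega>)) borel (\<lambda>\<omega>. Im (X \<omega>))"
    and R: "centred_normal M (v / 2) (\<lambda>\<omega>. Re (X \<omega>))"
    and I: "centred_normal M (v / 2) (\<lambda>\<omega>. Im (X \<omega>))"
    using assms by (auto simp: complex_normal_def)
  have "indep_var borel ((\<lambda>x. cos \<phi> * x) \<circ> (\<lambda>\<omega>. Re (X \<omega>))) borel ((\<lambda>x. (- sin \<phi>) * x) \<circ> (\<lambda>\<omega>. Im (X \<omega>)))"
    by (rule indep_var_compose[OF ind]) auto
  then have "centred_normal M ((cos \<phi>)\<^sup>2 * (v / 2) + (- sin \<phi>)\<^sup>2 * (v / 2))
     (\<lambda>\<omega>. cos \<phi> * Re (X \<omega>) + (- sin \<phi>) * Im (X \<omega>))"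
    using assms by (intro centred_normal_add centred_normal_cmult R I) (auto simp: o_def)
  moreover have "(cos \<phi>)\<^sup>2 * (v / 2) + (- sin \<phi>)\<^sup>2 * (v / 2) = v / 2"
    by (metis distrib_right mult_1 power2_minus sin_cos_squared_add2)
  moreover have "(\<lambda>\<omega>. cos \<phi> * Re (X \<omega>) + (- sin \<phi>) * Im (X \<omega>)) = (\<lambda>\<omega>. Re (cis \<phi> * X \<omega>))"
    by simp
  ultimately show ?thesis by metis
qed

text \<open>Twice the modulus is the integral of the absolute projections over a half turn. After
  exchanging the integrals, every angle contributes the same mean \<open>sqrt (v / pi)\<close>, over
  an interval of length \<open>pi\<close>. Only the laws of the projections enter; working with
  non-negative integrals yields integrability along with the value.\<close>

lemma expectation_cmod_isotropic:
  assumes [measurable]: "S \<in> borel_measurable M" and "v \<ge> 0"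
    and S: "\<And>\<phi>. centred_normal M (v / 2) (\<lambda>\<omega>. Re (cis \<phi> * S \<omega>))"
  shows "integrable M (\<lambda>\<omega>. cmod (S \<omega>))" "expectation (\<lambda>\<omega>. cmod (S \<omega>)) = sqrt (pi * v) / 2"
proof -
  interpret L: pair_sigma_finite M lborel ..
  let ?I = "{-(pi/2)..pi/2}"
  have [measurable]: "cis \<in> borel_measurable borel"
    by (intro borel_measurable_continuous_onI continuous_intros)
  have "(\<integral>\<^sup>+\<omega>. ennreal (2 * cmod (S \<omega>)) \<partial>M)
    = (\<integral>\<^sup>+\<omega>. (\<integral>\<^sup>+\<phi>. ennreal \<bar>Re (cis \<phi> * S \<omega>)\<bar> * indicator ?I \<phi> \<partial>lborel) \<partial>M)"
  proof (intro nn_integral_cong)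
    fix \<omega>
    have "ennreal (2 * cmod (S \<omega>))
        = (\<integral>\<^sup>+\<phi>. ennreal (indicator ?I \<phi> * \<bar>Re (cis \<phi> * S \<omega>)\<bar>) \<partial>lborel)"
      by (rule nn_integral_has_integral_lebesgue[OF abs_ge_zero integral_abs_Re_cis_mult, symmetric])
    also have "\<dots> = (\<integral>\<^sup>+\<phi>. ennreal \<bar>Re (cis \<phi> * S \<omega>)\<bar> * indicator ?I \<phi> \<partial>lborel)"
      by (intro nn_integral_cong) (auto split: split_indicator)
    finally show "ennreal (2 * cmod (S \<omega>))
        = (\<integral>\<^sup>+\<phi>. ennreal \<bar>Re (cis \<phi> * S \<omega>)\<bar> * indicator ?I \<phi> \<partial>lborel)" .
  qed
  also have "\<dots> = (\<integral>\<^sup>+\<phi>. (\<integral>\<^sup>+\<omega>. ennreal \<bar>Re (cis \<phi> * S \<omega>)\<bar> * indicator ?I \<phi> \<partial>M) \<partial>lborel)"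
    by (rule L.Fubini'[symmetric]) measurable
  also have "\<dots> = (\<integral>\<^sup>+\<phi>. ennreal (sqrt (v / pi)) * indicator ?I \<phi> \<partial>lborel)"
  proof (intro nn_integral_cong)
    fix \<phi>
    have "(\<integral>\<^sup>+\<omega>. ennreal \<bar>Re (cis \<phi> * S \<omega>)\<bar> \<partial>M) = ennreal (sqrt (v / pi))"
      using centred_normal_expectation[OF S[of \<phi>]] \<open>v \<ge> 0\<close> by (subst nn_integral_eq_integral) auto
    then show "(\<integral>\<^sup>+\<omega>. ennreal \<bar>Re (cis \<phi> * S \<omega>)\<bar> * indicator ?I \<phi> \<partial>M)
        = ennreal (sqrt (v / pi)) * indicator ?I \<phi>"
      by (subst nn_integral_multc) auto
  qed
  also have "\<dots> = ennreal (sqrt (v / pi) * pi)"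
    using \<open>v \<ge> 0\<close> by (simp add: nn_integral_cmult_indicator ennreal_mult)
  also have "sqrt (v / pi) * pi = sqrt (pi * v)"
    by (simp add: real_sqrt_divide real_sqrt_mult field_simps)
  finally have "has_bochner_integral M (\<lambda>\<omega>. 2 * cmod (S \<omega>)) (sqrt (pi * v))"
    using \<open>v \<ge> 0\<close> by (intro has_bochner_integral_nn_integral) auto
  then show "integrable M (\<lambda>\<omega>. cmod (S \<omega>))" "expectation (\<lambda>\<omega>. cmod (S \<omega>)) = sqrt (pi * v) / 2"
    by (auto simp: has_bochner_integral_iff)
qed

text \<open>Each projection of the sum is a weighted sum of independent real Gaussians of variance
  1/2, so its law does not depend on the angle and the isotropic case applies.\<close>

lemma expectation_cmod_complex_normal_sum:
  fixes v :: "'i \<Rightarrow> real" and X :: "'i \<Rightarrow> 'a \<Rightarrow> complex"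
  assumes "finite I" and ind: "indep_vars (\<lambda>_. borel) X I"
    and X: "\<And>i. i \<in> I \<Longrightarrow> complex_normal M 1 (X i)"
  defines "S \<equiv> \<lambda>\<omega>. \<Sum>i\<in>I. v i *\<^sub>R X i \<omega>"
  shows "integrable M (\<lambda>\<omega>. cmod (S \<omega>))"
    "expectation (\<lambda>\<omega>. cmod (S \<omega>)) = sqrt (pi * (\<Sum>i\<in>I. (v i)\<^sup>2)) / 2"
proof -
  have [measurable]: "X i \<in> borel_measurable M" if "i \<in> I" for i
    using X[OF that] by (simp add: complex_normal_def)
  have "centred_normal M ((\<Sum>i\<in>I. (v i)\<^sup>2) / 2) (\<lambda>\<omega>. Re (cis \<phi> * S \<omega>))" for \<phi>
  proof -
    have "centred_normal M (\<Sum>i\<in>I. (v i)\<^sup>2 * (1 / 2)) (\<lambda>\<omega>. \<Sum>i\<in>I. v i * Re (cis \<phi> * X i \<omega>))"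
      using X \<open>finite I\<close>
      by (intro centred_normal_sum indep_vars_compose2[OF ind] centred_normal_cmult complex_normal_rotate)
        auto
    then show ?thesis
      by (simp add: S_def sum_distrib_left sum_divide_distrib algebra_simps sum.distrib sum_subtractf)
  qed
  moreover have "S \<in> borel_measurable M" "(\<Sum>i\<in>I. (v i)\<^sup>2) \<ge> 0"
    by (auto simp: S_def intro: sum_nonneg)
  ultimately show "integrable M (\<lambda>\<omega>. cmod (S \<omega>))"
    "expectation (\<lambda>\<omega>. cmod (S \<omega>)) = sqrt (pi * (\<Sum>i\<in>I. (v i)\<^sup>2)) / 2"
    by - (intro expectation_cmod_isotropic; assumption)+
qed

end

section \<open>Subgradient argument for the aligned channels\<close>

text \<open>\<open>f t - t * s\<close> is minimal at 0, so its derivative \<open>D - s\<close>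
  vanishes there.\<close>

lemma DERIV_unique_tangent_below:
  fixes f :: "real \<Rightarrow> real"
  assumes "(f has_real_derivative D) (at 0)" and "\<And>t. f 0 + t * s \<le> f t"
  shows "s = D"
proof -
  have "((\<lambda>t. f t - t * s) has_real_derivative D - s) (at 0)"
    using assms(1) by (auto intro!: derivative_eq_intros)
  then have "D - s = 0"
    by (rule DERIV_local_min[where d = 1]) (use assms(2) in \<open>auto simp: algebra_simps\<close>)
  then show ?thesis by simp
qed

text \<open>For \<open>z = S\<close> this is the alignment \<open>u S = |S|\<close>. At 0 both sides
  vanish, so no exceptional set arises.\<close>

lemma cis_Arg_cnj_mult_self: "cis (Arg (cnj z)) * z = of_real (cmod z)"
proof (cases "z = 0")
  case False
  then show ?thesis
    by (simp add: cis_Arg sgn_eq complex_norm_square[symmetric] mult.commute power2_eq_square)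
qed simp

lemma cis_neg_Arg_cnj_mult: "cnj z * cis (- Arg (cnj z)) = of_real (cmod z)"
proof (cases "z = 0")
  case False
  then show ?thesis
    by (simp add: cis_Arg sgn_eq complex_norm_square[symmetric] mult.commute power2_eq_square flip: cis_cnj)
qed simp

context prob_space
begin

text \<open>The mean modulus \<open>F t\<close> is the square root of a quadratic in
  \<open>t\<close>, up to a factor. Positivity of the total variance makes it differentiable at 0,
  and the linear coefficient \<open>2 * v i\<close> fixes the slope. The weight
  \<open>v i = 0\<close> is allowed and gives mean 0, which is the case of an interferer.\<close>

lemma expectation_aligned_component:
  fixes v :: "'i \<Rightarrow> real" and X :: "'i \<Rightarrow> 'a \<Rightarrow> complex"
  assumes fin: "finite I" and ind: "indep_vars (\<lambda>_. borel) X I"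
    and X: "\<And>i. i \<in> I \<Longrightarrow> complex_normal M 1 (X i)"
    and i: "i \<in> I" and pos: "(\<Sum>j\<in>I. (v j)\<^sup>2) > 0"
  defines "S \<equiv> \<lambda>\<omega>. \<Sum>j\<in>I. v j *\<^sub>R X j \<omega>"
  shows "integrable M (\<lambda>\<omega>. Re (cis (Arg (cnj (S \<omega>))) * X i \<omega>))"
    "expectation (\<lambda>\<omega>. Re (cis (Arg (cnj (S \<omega>))) * X i \<omega>))
      = sqrt pi / 2 * (v i / sqrt (\<Sum>j\<in>I. (v j)\<^sup>2))"
proof -
  let ?W = "\<Sum>j\<in>I. (v j)\<^sup>2"
  let ?R = "\<lambda>\<omega>. Re (cis (Arg (cnj (S \<omega>))) * X i \<omega>)"
  have X_meas [measurable]: "X j \<in> borel_measurable M" if "j \<in> I" for j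
    using X[OF that] by (simp add: complex_normal_def)
  note [measurable] = X_meas[OF i]
  have [measurable]: "S \<in> borel_measurable M" unfolding S_def by measurable
  have R_meas: "?R \<in> borel_measurable M" by measurable
  \<comment> \<open>The unit factor stays fixed while \<open>t\<close> varies: it attains the
    modulus at \<open>t = 0\<close>, and elsewhere a real part is at most a modulus.\<close>
  have subgradient: "cmod (S \<omega>) + t * ?R \<omega> \<le> cmod (S \<omega> + t *\<^sub>R X i \<omega>)" for \<omega> t
  proof -
    have "cmod (S \<omega>) + t * ?R \<omega> = Re (cis (Arg (cnj (S \<omega>))) * (S \<omega> + t *\<^sub>R X i \<omega>))"
      by (simp only: distrib_left cis_Arg_cnj_mult_self plus_complex.sel Re_complex_of_real
          mult_scaleR_right scaleR_complex.sel)
    also have "\<dots> \<le> cmod (S \<omega> + t *\<^sub>R X i \<omega>)"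
      using complex_Re_le_cmod by (metis norm_mult norm_cis mult_1)
    finally show ?thesis .
  qed
  define F where "F t = expectation (\<lambda>\<omega>. cmod (S \<omega> + t *\<^sub>R X i \<omega>))" for t
  have shifted: "integrable M (\<lambda>\<omega>. cmod (S \<omega> + t *\<^sub>R X i \<omega>))"
    "F t = sqrt (pi * (?W + 2 * v i * t + t\<^sup>2)) / 2" for t
  proof -
    \<comment> \<open>The perturbation is absorbed into the weight of \<open>i\<close>, so the
      closed form for weighted sums holds for every \<open>t\<close>.\<close>
    let ?v = "\<lambda>j. v j + (if j = i then t else 0)"
    have "S \<omega> + t *\<^sub>R X i \<omega> = (\<Sum>j\<in>I. ?v j *\<^sub>R X j \<omega>)" for \<omega>
      using fin i by (simp add: S_def scaleR_add_left sum.distrib if_distrib[of "\<lambda>c. c *\<^sub>R _"] sum.delta cong: if_cong)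
    moreover have "(\<Sum>j\<in>I. (?v j)\<^sup>2) = (\<Sum>j\<in>I. (v j)\<^sup>2 + (if j = i then 2 * v i * t + t\<^sup>2 else 0))"
      by (intro sum.cong) (auto simp: power2_sum)
    then have "(\<Sum>j\<in>I. (?v j)\<^sup>2) = ?W + 2 * v i * t + t\<^sup>2"
      using fin i by (simp add: sum.distrib sum.delta)
    ultimately show "integrable M (\<lambda>\<omega>. cmod (S \<omega> + t *\<^sub>R X i \<omega>))"
      "F t = sqrt (pi * (?W + 2 * v i * t + t\<^sup>2)) / 2"
      using expectation_cmod_complex_normal_sum[OF fin ind X, of ?v] by (simp_all add: F_def)
  qed
  \<comment> \<open>Weights concentrated at \<open>i\<close> reduce the sum to \<open>X i\<close>,
    whose modulus dominates \<open>?R\<close>.\<close>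
  have "integrable M (\<lambda>\<omega>. cmod (X i \<omega>))"
    using expectation_cmod_complex_normal_sum(1)[OF fin ind X, of "\<lambda>j. if j = i then 1 else 0"] fin i
    by (simp add: if_distrib[of "\<lambda>c. c *\<^sub>R _"] sum.delta cong: if_cong)
  moreover have "norm (?R \<omega>) \<le> norm (cmod (X i \<omega>))" for \<omega>
    using abs_Re_le_cmod[of "cis (Arg (cnj (S \<omega>))) * X i \<omega>"] by (simp only: norm_mult norm_cis mult_1 real_norm_def abs_norm_cancel)
  ultimately show int: "integrable M ?R"
    using R_meas by (intro Bochner_Integration.integrable_bound[of M "\<lambda>\<omega>. cmod (X i \<omega>)" ?R] AE_I2)
  have "F 0 + t * expectation ?R \<le> F t" for t
  proof -
    have S_int: "integrable M (\<lambda>\<omega>. cmod (S \<omega>))" using shifted(1)[of 0] by simp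
    have "F 0 + t * expectation ?R = expectation (\<lambda>\<omega>. cmod (S \<omega>) + t * ?R \<omega>)"
      unfolding F_def using int S_int
      by (simp only: Bochner_Integration.integral_add integrable_mult_right integral_mult_right_zero
          scaleR_zero_left add_0_right)
    also have "\<dots> \<le> F t"
      unfolding F_def by (intro integral_mono subgradient shifted Bochner_Integration.integrable_add integrable_mult_right int S_int)
    finally show ?thesis .
  qed
  moreover have "(F has_real_derivative sqrt pi / 2 * (v i / sqrt ?W)) (at 0)"
  proof -
    have "((\<lambda>t. sqrt (pi * (?W + 2 * v i * t + t\<^sup>2)) / 2) has_real_derivative
        (inverse (sqrt (pi * ?W)) / 2 * (pi * (2 * v i))) / 2) (at 0)"
      using pos by (auto intro!: derivative_eq_intros simp: mult_less_0_iff zero_less_mult_iff)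
    moreover have "(inverse (sqrt (pi * ?W)) / 2 * (pi * (2 * v i))) / 2 = sqrt pi / 2 * (v i / sqrt ?W)"
      using pos by (simp add: real_sqrt_mult field_simps)
    ultimately show ?thesis using shifted(2) by (metis (no_types, lifting) ext)
  qed
  ultimately show "expectation ?R = sqrt pi / 2 * (v i / sqrt ?W)"
    by (intro DERIV_unique_tangent_below)
qed

text \<open>The modulus of \<open>X d\<close> and the aligned component come from disjoint groups of
  independent variables, so the expectation factors; \<open>pi / 4\<close> is the product of two
  factors \<open>sqrt pi / 2\<close>.\<close>

lemma expectation_aligned_product:
  fixes v :: "'i \<Rightarrow> real" and X :: "'i \<Rightarrow> 'a \<Rightarrow> complex"
  assumes fin: "finite I" "d \<notin> I" and ind: "indep_vars (\<lambda>_. borel) X (insert d I)"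
    and X: "\<And>i. i \<in> insert d I \<Longrightarrow> complex_normal M 1 (X i)"
    and i: "i \<in> I" and pos: "(\<Sum>j\<in>I. (v j)\<^sup>2) > 0"
  defines "S \<equiv> \<lambda>\<omega>. \<Sum>j\<in>I. v j *\<^sub>R X j \<omega>"
  shows "integrable M (\<lambda>\<omega>. cmod (X d \<omega>) * Re (cis (Arg (cnj (S \<omega>))) * X i \<omega>))"
    "expectation (\<lambda>\<omega>. cmod (X d \<omega>) * Re (cis (Arg (cnj (S \<omega>))) * X i \<omega>))
      = pi / 4 * (v i / sqrt (\<Sum>j\<in>I. (v j)\<^sup>2))"
proof -
  let ?R = "\<lambda>\<omega>. Re (cis (Arg (cnj (S \<omega>))) * X i \<omega>)"
  \<comment> \<open>Both factors are written as functions of the families restricted to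
    \<open>{d}\<close> and to \<open>I\<close>; the second function recomputes \<open>S\<close> from
    its argument.\<close>
  have "indep_var borel ((\<lambda>f. cmod (f d)) \<circ> (\<lambda>\<omega>. restrict (\<lambda>i. X i \<omega>) {d}))
     borel ((\<lambda>f. Re (cis (Arg (cnj (\<Sum>j\<in>I. v j *\<^sub>R f j))) * f i)) \<circ> (\<lambda>\<omega>. restrict (\<lambda>i. X i \<omega>) I))"
  proof (rule indep_var_compose[OF indep_var_restrict[OF ind]])
    have [measurable]: "(\<lambda>f. f j) \<in> PiM I (\<lambda>_. borel) \<rightarrow>\<^sub>M (borel :: complex measure)" if "j \<in> I" for j
      using that by measurable
    note [measurable] = this[OF i]
    show "(\<lambda>f. Re (cis (Arg (cnj (\<Sum>j\<in>I. v j *\<^sub>R f j))) * f i)) \<in> borel_measurable (PiM I (\<lambda>_. borel))"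
      by measurable
  qed (use fin in auto)
  moreover have "(\<lambda>f. Re (cis (Arg (cnj (\<Sum>j\<in>I. v j *\<^sub>R f j))) * f i)) \<circ> (\<lambda>\<omega>. restrict (\<lambda>i. X i \<omega>) I) = ?R"
    using i by (simp add: o_def S_def cong: sum.cong)
  moreover have "(\<lambda>f. cmod (f d)) \<circ> (\<lambda>\<omega>. restrict (\<lambda>i. X i \<omega>) {d}) = (\<lambda>\<omega>. cmod (X d \<omega>))"
    by (simp add: o_def)
  ultimately have indep: "indep_var borel (\<lambda>\<omega>. cmod (X d \<omega>)) borel ?R" by metis
  have "integrable M (\<lambda>\<omega>. cmod (X d \<omega>))" "expectation (\<lambda>\<omega>. cmod (X d \<omega>)) = sqrt pi / 2"
    using expectation_cmod_complex_normal_sum[of "{d}" X "\<lambda>_. 1"] indep_vars_subset[OF ind] X by auto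
  moreover have "integrable M ?R" "expectation ?R = sqrt pi / 2 * (v i / sqrt (\<Sum>j\<in>I. (v j)\<^sup>2))"
    unfolding S_def using expectation_aligned_component[OF fin(1) indep_vars_subset[OF ind] X i pos] by blast+
  ultimately show "integrable M (\<lambda>\<omega>. cmod (X d \<omega>) * ?R \<omega>)"
    "expectation (\<lambda>\<omega>. cmod (X d \<omega>) * ?R \<omega>) = pi / 4 * (v i / sqrt (\<Sum>j\<in>I. (v j)\<^sup>2))"
    using indep_var_integrable[OF indep] indep_var_lebesgue_integral[OF indep]
    by (simp_all only: mult.assoc[symmetric] times_divide_times_eq real_sqrt_mult_self) simp_all
qed

end

section \<open>From channel vectors to the coefficients\<close>

text \<open>The matrix is diagonal, so each entry is merely rotated. The first part of the phase
  cancels the argument of \<open>cnj (hp $ n)\<close> and leaves a modulus; the second part is the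
  aligning factor. The identity is pointwise, zero entries included.\<close>

lemma coeff_ell_phases_II:
  "coeff_ell b p lam (phases_II K \<beta> P hp hr) hp h
    = b * sqrt p / lam * (\<Sum>n\<in>UNIV. cmod (hp $ n) *
        Re (cis (Arg (cnj (\<Sum>k=1..K. (1 / (\<beta> k * sqrt (P k))) *\<^sub>R (hr k $ n)))) * h $ n))"
proof -
  have "cnj (hp $ n) * (reflecting_matrix (phases_II K \<beta> P hp hr) *v h) $ n
    = cmod (hp $ n) *\<^sub>R
        (cis (Arg (cnj (\<Sum>k=1..K. (1 / (\<beta> k * sqrt (P k))) *\<^sub>R (hr k $ n)))) * h $ n)" for n
  proof -
    have "(reflecting_matrix (phases_II K \<beta> P hp hr) *v h) $ n = cis (phases_II K \<beta> P hp hr $ n) * h $ n"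
      by (simp add: reflecting_matrix_def matrix_vector_mult_def if_distrib[of "\<lambda>c. c * _"] sum.delta cong: if_cong)
    also have "phases_II K \<beta> P hp hr $ n = - Arg (cnj (hp $ n))
        + Arg (cnj (\<Sum>k=1..K. (1 / (\<beta> k * sqrt (P k))) *\<^sub>R (hr k $ n)))"
      by (simp add: phases_II_def scaleR_conv_of_real)
    finally show ?thesis
      by (simp only: cis_mult[symmetric] mult.assoc[symmetric] cis_neg_Arg_cnj_mult scaleR_conv_of_real)
  qed
  then show ?thesis
    unfolding coeff_ell_def herm_prod_def by (simp only: Re_sum scaleR_complex.sel)
qed

context prob_space
begin

lemma expectation_Re_noise:
  assumes "complex_normal_vec M v z" "v \<ge> 0"
  shows "integrable M (\<lambda>\<omega>. \<chi> d. Re (z \<omega> $ d))" "expectation (\<lambda>\<omega>. \<chi> d. Re (z \<omega> $ d)) = 0"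
proof -
  have "has_bochner_integral M (\<lambda>\<omega>. Re (z \<omega> $ d)) 0" for d
    using assms centred_normal_expectation[of "v / 2" "\<lambda>\<omega>. Re (z \<omega> $ d)"]
    by (auto simp: complex_normal_vec_def complex_normal_def has_bochner_integral_iff)
  \<comment> \<open>Expansion in the standard basis lifts the scalar integrals to a vector-valued
    one.\<close>
  then have "has_bochner_integral M (\<lambda>\<omega>. \<Sum>d\<in>UNIV. Re (z \<omega> $ d) *\<^sub>R axis d (1::real)) (\<Sum>d\<in>UNIV. 0 *\<^sub>R axis d 1)"
    by (intro has_bochner_integral_sum has_bochner_integral_scaleR_left) auto
  moreover have "(\<Sum>d\<in>UNIV. Re (z \<omega> $ d) *\<^sub>R axis d (1::real)) = (\<chi> d. Re (z \<omega> $ d))" for \<omega>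
    by (simp add: vec_eq_iff axis_def if_distrib[of "\<lambda>c. _ * c"] sum.delta cong: if_cong)
  ultimately show "integrable M (\<lambda>\<omega>. \<chi> d. Re (z \<omega> $ d))" "expectation (\<lambda>\<omega>. \<chi> d. Re (z \<omega> $ d)) = 0"
    by (simp_all add: has_bochner_integral_iff)
qed

text \<open>Without the noise all sources share the type \<open>complex ^ 'n\<close>, so
  independence of the generated events becomes \<open>indep_vars\<close>. The function
  \<open>z'\<close> only fills the \<open>Noise\<close> case, which lies outside the index
  set.\<close>

lemma indep_vars_channels:
  assumes "sources_independent M I hp hr z"
    and "complex_normal_vec M 1 hp" "\<And>i. i \<in> I \<Longrightarrow> complex_normal_vec M 1 (hr i)"
  shows "indep_vars (\<lambda>_. borel) (case_source hp hr z') (insert Direct (Reflected ` I))"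
    (is "indep_vars _ ?X ?J")
proof -
  have "indep_sets (case_source (generated_events M hp) (\<lambda>i. generated_events M (hr i)) (generated_events M z)) ?J"
    using assms(1) unfolding sources_independent_def by (rule indep_sets_mono_index[rotated]) auto
  moreover have "case_source (generated_events M hp) (\<lambda>i. generated_events M (hr i)) (generated_events M z) s
      = {?X s -` A \<inter> space M |A. A \<in> sets borel}" if "s \<in> ?J" for s
    using that by (cases s) (simp_all add: generated_events_def image_iff)
  ultimately have "indep_sets (\<lambda>s. {?X s -` A \<inter> space M |A. A \<in> sets borel}) ?J"
    using indep_sets_cong[OF refl] by (metis (no_types, lifting))
  then show ?thesis
    using assms by (auto simp: indep_vars_def2 complex_normal_vec_def)
qed

text \<open>One formula for targets and interferers; by linearity the reflecting elements contribute
  \<open>CARD('n)\<close> equal terms.\<close>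

lemma expectation_coeff_ell:
  fixes hp :: "'a \<Rightarrow> complex ^ 'n" and b p lam :: real
  assumes hp: "complex_normal_vec M 1 hp"
    and hr: "\<And>i. i \<in> {1..L} \<Longrightarrow> complex_normal_vec M 1 (hr i)"
    and ind: "sources_independent M {1..L} hp hr z"
    and w: "\<And>k. k \<in> {1..K} \<Longrightarrow> w k = 1 / (\<beta> k * sqrt (P k))"
    and K: "K \<le> L" and i: "i \<in> {1..L}" and pos: "(\<Sum>k=1..K. (w k)\<^sup>2) > 0"
  defines "ell \<equiv> \<lambda>\<omega>. coeff_ell b p lam (phases_II K \<beta> P (hp \<omega>) (\<lambda>k. hr k \<omega>)) (hp \<omega>) (hr i \<omega>)"
  shows "integrable M ell"
    "expectation ell = b * sqrt p / lam * (real CARD('n) * (pi / 4 *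
      ((if i \<le> K then w i else 0) / sqrt (\<Sum>k=1..K. (w k)\<^sup>2))))"
proof -
  let ?X = "\<lambda>n s \<omega>. case_source hp hr (\<lambda>_. 0) s \<omega> $ n"
  \<comment> \<open>Extending the weights by 0 to the interferers makes \<open>S\<close> a sum over
    all reflected sources, so that any \<open>i\<close> up to \<open>L\<close> is an admissible
    index. The values at \<open>Direct\<close> and \<open>Noise\<close> are placeholders.\<close>
  define v where "v = case_source 0 (\<lambda>k. if k \<le> K then w k else 0) 0"
  let ?I = "Reflected ` {1..L}"
  let ?S = "\<lambda>n \<omega>. \<Sum>k=1..K. (1 / (\<beta> k * sqrt (P k))) *\<^sub>R (hr k \<omega> $ n)"
  let ?Z = "\<lambda>n \<omega>. cmod (hp \<omega> $ n) * Re (cis (Arg (cnj (?S n \<omega>))) * hr i \<omega> $ n)"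
  have range: "{1..L} \<inter> {k. k \<le> K} = {1..K}" using K by auto
  have W: "(\<Sum>s\<in>?I. (v s)\<^sup>2) = (\<Sum>k=1..K. (w k)\<^sup>2)"
    by (simp add: sum.reindex inj_on_def v_def if_distrib[of "\<lambda>c. c\<^sup>2"] sum.If_cases range
        cong: if_cong del: One_nat_def)
  have S: "(\<Sum>s\<in>?I. v s *\<^sub>R ?X n s \<omega>) = ?S n \<omega>" for n \<omega>
    using w by (simp add: sum.reindex inj_on_def v_def if_distrib[of "\<lambda>c. c *\<^sub>R _"] sum.If_cases range
        cong: if_cong del: One_nat_def)
  have "indep_vars (\<lambda>_. borel) (?X n) (insert Direct ?I)" for n
    using indep_vars_channels[OF ind hp hr] by (rule indep_vars_compose2) auto
  moreover have "complex_normal M 1 (?X n s)" if "s \<in> insert Direct ?I" for n s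
    using that hp hr by (auto simp: complex_normal_vec_def)
  moreover have "Direct \<notin> ?I" by auto
  ultimately have "integrable M (?Z n)"
    "expectation (?Z n) = pi / 4 * ((if i \<le> K then w i else 0) / sqrt (\<Sum>k=1..K. (w k)\<^sup>2))" for n
    using expectation_aligned_product[of ?I Direct "?X n" "Reflected i" v] i pos unfolding W S
    by (auto simp: v_def simp del: times_complex.sel)
  then have "has_bochner_integral M (\<lambda>\<omega>. b * sqrt p / lam * (\<Sum>n\<in>UNIV. ?Z n \<omega>))
    (b * sqrt p / lam * (\<Sum>n\<in>(UNIV::'n set). pi / 4 * ((if i \<le> K then w i else 0) / sqrt (\<Sum>k=1..K. (w k)\<^sup>2))))"
    by (intro has_bochner_integral_mult_right has_bochner_integral_sum) (simp only: has_bochner_integral_iff)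
  then show "integrable M ell"
    "expectation ell = b * sqrt p / lam * (real CARD('n) * (pi / 4 *
      ((if i \<le> K then w i else 0) / sqrt (\<Sum>k=1..K. (w k)\<^sup>2))))"
    unfolding ell_def coeff_ell_phases_II by (simp_all only: has_bochner_integral_iff sum_constant)
qed

end

theorem proposition2:
  fixes \<Omega> :: "'a measure"
    and K M :: nat
    and hp :: "'a \<Rightarrow> complex ^ 'n" and hr :: "nat \<Rightarrow> 'a \<Rightarrow> complex ^ 'n"
    and z :: "'a \<Rightarrow> complex ^ 'd"
    and \<sigma> G lam :: real
    and \<beta> P p w :: "nat \<Rightarrow> real"
    and g gi :: "nat \<Rightarrow> real ^ 'd"
    and \<theta> :: "'a \<Rightarrow> real ^ 'n"
    and ell :: "nat \<Rightarrow> 'a \<Rightarrow> real"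
    and g_hat :: "'a \<Rightarrow> real ^ 'd"
  assumes "prob_space \<Omega>"
    and "K \<ge> 1" and "M \<ge> 1"
    and "complex_normal_vec \<Omega> 1 hp"
    and "\<And>i. i \<in> {1..K+M} \<Longrightarrow> complex_normal_vec \<Omega> 1 (hr i)"
    and "complex_normal_vec \<Omega> (\<sigma>\<^sup>2) z"
    and "sources_independent \<Omega> {1..K+M} hp hr z"
    and "\<And>i. i \<in> {1..K+M} \<Longrightarrow> \<beta> i > 0"
    and "\<And>k. k \<in> {1..K} \<Longrightarrow> P k > 0"
    and "\<And>i. i \<in> {1..K+M} \<Longrightarrow> p i > 0"
    and "G > 0"
    and "\<And>k. k \<in> {1..K} \<Longrightarrow> norm (g k) \<le> G"
    and "\<And>m. m \<in> {K+1..K+M} \<Longrightarrow> norm (gi m) = 1"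
    and "\<And>k. k \<in> {1..K} \<Longrightarrow> sqrt (p k) = sqrt (P k) / G"
    and "\<And>k. k \<in> {1..K} \<Longrightarrow> w k = 1 / (\<beta> k * sqrt (P k))"
    and "lam = pi * real CARD('n) * real K / (4 * G * sqrt (\<Sum>k=1..K. (w k)\<^sup>2))"
    and "\<And>\<omega>. \<theta> \<omega> = phases_II K \<beta> P (hp \<omega>) (\<lambda>k. hr k \<omega>)"
    and "\<And>i \<omega>. ell i \<omega> = coeff_ell (\<beta> i) (p i) lam (\<theta> \<omega>) (hp \<omega>) (hr i \<omega>)"
    and "\<And>\<omega>. g_hat \<omega> = gradient_estimate K M lam (\<lambda>i. ell i \<omega>) g gi (z \<omega>)"
  shows "integrable \<Omega> g_hat \<and> integral\<^sup>L \<Omega> g_hat = true_gradient K g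
    \<and> (\<forall>k\<in>{1..K}. integrable \<Omega> (ell k) \<and> integral\<^sup>L \<Omega> (ell k) = 1 / real K)
    \<and> (\<forall>m\<in>{K+1..K+M}. integrable \<Omega> (ell m) \<and> integral\<^sup>L \<Omega> (ell m) = 0)"
proof -
  interpret prob_space \<Omega> by fact
  let ?W = "\<Sum>k=1..K. (w k)\<^sup>2"
  have w_pos: "w k > 0" if "k \<in> {1..K}" for k
    using that assms(8)[of k] assms(9)[of k] assms(15)[of k] by simp
  then have W: "?W > 0"
    using \<open>K \<ge> 1\<close> by (intro sum_pos zero_less_power) auto
  have ell: "integrable \<Omega> (ell i)"
    "expectation (ell i) = \<beta> i * sqrt (p i) / lam * (real CARD('n) * (pi / 4 *
      ((if i \<le> K then w i else 0) / sqrt ?W)))" if "i \<in> {1..K+M}" for i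
  proof -
    have *: "ell i = (\<lambda>\<omega>. coeff_ell (\<beta> i) (p i) lam
        (phases_II K \<beta> P (hp \<omega>) (\<lambda>k. hr k \<omega>)) (hp \<omega>) (hr i \<omega>))"
      using assms(17,18) by auto
    show "integrable \<Omega> (ell i)"
      "expectation (ell i) = \<beta> i * sqrt (p i) / lam * (real CARD('n) * (pi / 4 *
      ((if i \<le> K then w i else 0) / sqrt ?W)))"
      unfolding * using expectation_coeff_ell[OF assms(4,5,7,15) _ that W] by auto
  qed
  have target: "expectation (ell k) = 1 / real K" if k: "k \<in> {1..K}" for k
  proof -
    have "\<beta> k > 0" "P k > 0" using k assms(8,9) by auto
    \<comment> \<open>Channel inversion: the power control and the weights give every target the
      same gain, free of \<open>\<beta> k\<close> and \<open>P k\<close>.\<close>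
    then have "\<beta> k * (sqrt (P k) / G) * w k = 1 / G" using assms(15)[OF k] \<open>G > 0\<close> by simp
    moreover have "expectation (ell k)
        = (\<beta> k * (sqrt (P k) / G) * w k) * (real CARD('n) * pi / (4 * sqrt ?W * lam))"
      using ell(2)[of k] k assms(14)[OF k] by (simp add: mult_ac)
    \<comment> \<open>The choice of \<open>lam\<close> makes the second factor equal to
      \<open>G / real K\<close>.\<close>
    ultimately show ?thesis
      using W \<open>G > 0\<close> \<open>K \<ge> 1\<close> by (simp add: assms(16) field_simps)
  qed
  \<comment> \<open>Here \<open>m > K\<close>, so the weight in the formula for the mean is
    0.\<close>
  have interferer: "expectation (ell m) = 0" if "m \<in> {K+1..K+M}" for m
    using ell(2)[of m] that by simp
  note noise = expectation_Re_noise[OF assms(6)]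
  have g_hat: "g_hat = (\<lambda>\<omega>. (\<Sum>k=1..K. ell k \<omega> *\<^sub>R g k) + (\<Sum>m=K+1..K+M. ell m \<omega> *\<^sub>R gi m)
       + (1 / lam) *\<^sub>R (\<chi> d. Re (z \<omega> $ d)))"
    using assms(19) by (auto simp: gradient_estimate_def)
  have "has_bochner_integral \<Omega> g_hat ((\<Sum>k=1..K. (1 / real K) *\<^sub>R g k)
      + (\<Sum>m=K+1..K+M. 0 *\<^sub>R gi m) + (1 / lam) *\<^sub>R 0)"
    unfolding g_hat using ell(1) target interferer noise
    by (intro has_bochner_integral_add has_bochner_integral_sum has_bochner_integral_scaleR_left
        has_bochner_integral_scaleR_right) (auto simp: has_bochner_integral_iff)
  then have "integrable \<Omega> g_hat" "expectation g_hat = true_gradient K g"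
    by (auto simp: has_bochner_integral_iff true_gradient_def scaleR_sum_right)
  then show ?thesis using ell(1) target interferer by auto
qed

end
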